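(* Let $$\Phi(X,Y)=\sum_{m,n\ge0}\frac{(m+n+1)!\,(2m+2n+1)!}{(m+1)!\,(2m+1)!\,(n+1)!\,(2n+1)!}\,X^{m+1}Y^{n+1}\in\mathbb Q[[X,Y]]$$ and $Z_3=1+X+Y+2\Phi(X,Y)$. Set $\sigma_1=X+Y-1$, $\sigma_2=XY-X-Y$, $\sigma_3=-XY$ and $$I=\sigma_1^2-12\sigma_2,\qquad J=\sigma_1^2\sigma_2-6\sigma_2^2+9\sigma_1\sigma_3,\qquad \mathcal D=(1+X)^2(1+Y)^2(X-Y)^2.$$ Then $$Z_3^6-I\,Z_3^4-8J\,Z_3^2-16\mathcal D=0.$$ Equivalently, $U=Z_3^2$ satisfies $U^3-IU^2-8JU-16\mathcal D=0$.
   Context: All identities are in the formal power series ring $\mathbb Q[[X,Y]]$. The series begins $\Phi=XY+X^2Y+XY^2+X^3Y+5X^2Y^2+XY^3+\cdots$. *)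

theory Defs
  imports "HOL-Computational_Algebra.Formal_Power_Series"
begin

text \<open>
  The ring \<open>\<rat>[[X,Y]]\<close> is represented as \<open>\<rat>[[X]][[Y]]\<close>: for \<open>F :: rat fps fps\<close>, the
  coefficient of \<open>X\<^sup>i Y\<^sup>j\<close> is \<open>fps_nth (fps_nth F j) i\<close>, with the exponent of the outer
  variable \<open>Y\<close> taken first.
\<close>

type_synonym qseries2 = "rat fps fps"

definition X :: qseries2 where
  "X = fps_const fps_X"

definition Y :: qseries2 where
  "Y = fps_X"

definition coeff2 :: "qseries2 \<Rightarrow> nat \<Rightarrow> nat \<Rightarrow> rat" where
  "coeff2 F i j = fps_nth (fps_nth F j) i"

definition series2 :: "(nat \<Rightarrow> nat \<Rightarrow> rat) \<Rightarrow> qseries2" where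
  "series2 c = Abs_fps (\<lambda>j. Abs_fps (\<lambda>i. c i j))"

lemma coeff2_series2 [simp]: "coeff2 (series2 c) i j = c i j"
  by (simp add: coeff2_def series2_def)

lemma qseries2_eqI: "(\<And>i j. coeff2 F i j = coeff2 G i j) \<Longrightarrow> F = G"
  by (simp add: coeff2_def fps_eq_iff)

lemma coeff2_monomial: "coeff2 (X ^ a * Y ^ b) i j = (if i = a \<and> j = b then 1 else 0)"
  by (simp add: coeff2_def X_def Y_def fps_const_power fps_X_power_mult_right_nth)

definition phi_term :: "nat \<Rightarrow> nat \<Rightarrow> rat" where
  "phi_term m n =
     (fact (m + n + 1) * fact (2 * m + 2 * n + 1)) /
     (fact (m + 1) * fact (2 * m + 1) * fact (n + 1) * fact (2 * n + 1))"

text \<open>The summand with index \<open>(m, n)\<close> contributes to the coefficient of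
  \<open>X\<^sup>i Y\<^sup>j\<close> with \<open>i = m + 1\<close> and \<open>j = n + 1\<close>.\<close>

definition Phi :: qseries2 where
  "Phi = series2 (\<lambda>i j. if 1 \<le> i \<and> 1 \<le> j then phi_term (i - 1) (j - 1) else 0)"

lemma coeff2_Phi:
  "coeff2 Phi (m + 1) (n + 1) = phi_term m n"
  "coeff2 Phi 0 j = 0"
  "coeff2 Phi i 0 = 0"
  by (simp_all add: Phi_def)

definition Z3 :: qseries2 where
  "Z3 = 1 + X + Y + 2 * Phi"

definition sigma1 :: qseries2 where
  "sigma1 = X + Y - 1"

definition sigma2 :: qseries2 where
  "sigma2 = X * Y - X - Y"

definition sigma3 :: qseries2 where
  "sigma3 = - (X * Y)"

definition I_inv :: qseries2 where
  "I_inv = sigma1 ^ 2 - 12 * sigma2"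

definition J_inv :: qseries2 where
  "J_inv = sigma1 ^ 2 * sigma2 - 6 * sigma2 ^ 2 + 9 * sigma1 * sigma3"

definition D_disc :: qseries2 where
  "D_disc = (1 + X) ^ 2 * (1 + Y) ^ 2 * (X - Y) ^ 2"

end

(*
  With the quartic Q(t) = t^2 (1+t)^2 - X (1+t)^2 - Y t^2, the mixed derivative of 2 Phi is minus the
  residue at t = 0 of 1/Q, expanded in powers of X/t^2 and Y/(1+t)^2.  Over Q[[X,Y]] the quartic
  factors as A B with A = t^2 - s t + p carrying the two roots that vanish at X = Y = 0, and
  B = t^2 + (2+s) t + 1 + s + q.  The residue picks out the roots of A, so it is a rational function
  of p, q, s.  It is also minus the mixed derivative of z = 1 - (1+s)(p+q) - s^2, which is
  1 + X - Y plus the sum of the critical values of H(t) = t + X/t + Y/(1+t) at the two roots of A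
  (indeed H' = Q / (t^2 (1+t)^2)).  Comparing boundary values gives Z3 = z.
  As half the difference of complementary pairs of the four critical values, z is a root of the
  sextic obtained from the resolvent cubic of their quartic.
*)
theory Submission
  imports Defs
begin

section \<open>Coefficients and the order of vanishing\<close>

lemma coeff2_0 [simp]: "coeff2 0 i j = 0"
  by (simp add: coeff2_def)

lemma coeff2_add [simp]: "coeff2 (F + G) i j = coeff2 F i j + coeff2 G i j"
  by (simp add: coeff2_def)

lemma coeff2_diff [simp]: "coeff2 (F - G) i j = coeff2 F i j - coeff2 G i j"
  by (simp add: coeff2_def)

lemma coeff2_minus [simp]: "coeff2 (- F) i j = - coeff2 F i j"
  by (simp add: coeff2_def)

lemma coeff2_1: "coeff2 1 i j = (if i = 0 \<and> j = 0 then 1 else 0)"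
  by (simp add: coeff2_def)

lemma coeff2_X: "coeff2 X i j = (if i = 1 \<and> j = 0 then 1 else 0)"
  using coeff2_monomial[of 1 0 i j] by simp

lemma coeff2_Y: "coeff2 Y i j = (if i = 0 \<and> j = 1 then 1 else 0)"
  using coeff2_monomial[of 0 1 i j] by simp

lemma coeff2_numeral_mult [simp]: "coeff2 (numeral n * F) i j = numeral n * coeff2 F i j"
  by (simp add: coeff2_def numeral_fps_const)

lemma coeff2_X_mult: "coeff2 (X * F) i j = (if i = 0 then 0 else coeff2 F (i - 1) j)"
  by (simp add: coeff2_def X_def)

lemma coeff2_Y_mult: "coeff2 (Y * F) i j = (if j = 0 then 0 else coeff2 F i (j - 1))"
  by (simp add: coeff2_def Y_def)

lemma coeff2_mult:
  "coeff2 (F * G) i j = (\<Sum>b\<le>j. \<Sum>a\<le>i. coeff2 F a b * coeff2 G (i - a) (j - b))"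
  by (simp add: coeff2_def fps_mult_nth fps_sum_nth atLeast0AtMost)

text \<open>Membership in the \<open>n\<close>-th power of the ideal \<open>(X, Y)\<close>; the
  iterations below converge in this adic topology.\<close>

definition vanishes_to :: "nat \<Rightarrow> qseries2 \<Rightarrow> bool" where
  "vanishes_to n F \<longleftrightarrow> (\<forall>i j. i + j < n \<longrightarrow> coeff2 F i j = 0)"

lemma vanishes_to_0 [simp]: "vanishes_to n 0"
  by (simp add: vanishes_to_def)

lemma vanishes_to_0_left [simp]: "vanishes_to 0 F"
  by (simp add: vanishes_to_def)

lemma vanishes_to_add [intro]: "vanishes_to n F \<Longrightarrow> vanishes_to n G \<Longrightarrow> vanishes_to n (F + G)"
  by (simp add: vanishes_to_def)

lemma vanishes_to_diff [intro]: "vanishes_to n F \<Longrightarrow> vanishes_to n G \<Longrightarrow> vanishes_to n (F - G)"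
  by (simp add: vanishes_to_def)

lemma vanishes_to_minus [intro]: "vanishes_to n F \<Longrightarrow> vanishes_to n (- F)"
  by (simp add: vanishes_to_def)

lemma vanishes_to_mono: "vanishes_to n F \<Longrightarrow> m \<le> n \<Longrightarrow> vanishes_to m F"
  by (simp add: vanishes_to_def)

lemma vanishes_to_mult:
  assumes "vanishes_to m F" "vanishes_to n G"
  shows "vanishes_to (m + n) (F * G)"
  unfolding vanishes_to_def
proof (intro allI impI)
  fix i j assume ij: "i + j < m + n"
  have "coeff2 F a b * coeff2 G (i - a) (j - b) = 0" if "a \<le> i" "b \<le> j" for a b
  proof (cases "a + b < m")
    case True
    then show ?thesis using assms(1) by (simp add: vanishes_to_def)
  next
    case False
    then have "(i - a) + (j - b) < n" using ij that by linarith
    then show ?thesis using assms(2) by (simp add: vanishes_to_def)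
  qed
  then show "coeff2 (F * G) i j = 0"
    unfolding coeff2_mult by (intro sum.neutral ballI) simp
qed

lemma vanishes_to_mult_left [intro]: "vanishes_to n G \<Longrightarrow> vanishes_to n (F * G)"
  using vanishes_to_mult[of 0 F n G] by simp

lemma vanishes_to_Suc_mult:
  "vanishes_to 1 F \<Longrightarrow> vanishes_to n G \<Longrightarrow> vanishes_to (Suc n) (F * G)"
  using vanishes_to_mult[of 1 F n G] by simp

lemma vanishes_to_all_imp_0: "(\<And>n. vanishes_to n F) \<Longrightarrow> F = 0"
  by (rule qseries2_eqI) (auto simp: vanishes_to_def intro: lessI)

text \<open>Adic completeness: coefficients of total degree at most \<open>m\<close> no longer
  change after \<open>f m\<close>, so the limit reads its \<open>(i, j)\<close> coefficient from
  \<open>f (i + j)\<close>.\<close>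

lemma vanishes_to_limit:
  assumes "\<And>n. vanishes_to (Suc n) (f (Suc n) - f n)"
  shows "\<exists>l. \<forall>n. vanishes_to (Suc n) (l - f n)"
proof -
  have stable: "coeff2 (f (m + d)) i j = coeff2 (f m) i j" if "i + j \<le> m" for i j m d
  proof (induction d)
    case (Suc d)
    then show ?case using assms[of "m + d"] that by (simp add: vanishes_to_def)
  qed simp
  have "vanishes_to (Suc n) (series2 (\<lambda>i j. coeff2 (f (i + j)) i j) - f n)" for n
    unfolding vanishes_to_def
  proof (intro allI impI)
    fix i j assume "i + j < Suc n"
    then show "coeff2 (series2 (\<lambda>i j. coeff2 (f (i + j)) i j) - f n) i j = 0"
      using stable[of i j "i + j" "n - (i + j)"] by simp
  qed
  then show ?thesis by blast
qed

section \<open>Factoring the quartic\<close>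

text \<open>Fixed-point iteration for the coefficients of A and B, where p = A(0) and q = B(-1). The
  equations come from comparing coefficients in Q = A B and isolating the linear terms, so apart
  from \<open>- X\<close> and \<open>- Y\<close> the right-hand sides are purely quadratic.\<close>

fun approx_pqs :: "nat \<Rightarrow> qseries2 \<times> qseries2 \<times> qseries2" where
  "approx_pqs 0 = (0, 0, 0)"
| "approx_pqs (Suc n) = (case approx_pqs n of (p, q, s) \<Rightarrow>
     (- X - p * (s + q), - Y - q * (s + p), - (2 * (p * q)) - s * (s + p + q)))"

text \<open>Contraction: on series without constant term, multiplication improves the accuracy of an
  approximation by one order.\<close>

lemma vanishes_to_mult_diff:
  assumes "vanishes_to 1 F" "vanishes_to 1 G'" "vanishes_to n (F - F')" "vanishes_to n (G - G')"
  shows "vanishes_to (Suc n) (F * G - F' * G')"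
proof -
  have "F * G - F' * G' = F * (G - G') + G' * (F - F')" by (simp add: algebra_simps)
  then show ?thesis using assms by (auto intro!: vanishes_to_Suc_mult vanishes_to_add)
qed

text \<open>Lifts the factorisation t^2 (1+t)^2 of Q at X = Y = 0, as in Hensel's lemma.\<close>

lemma ex_pqs:
  "\<exists>p q s. vanishes_to 1 p \<and> vanishes_to 1 q \<and> vanishes_to 1 s \<and>
     p = - X - p * (s + q) \<and> q = - Y - q * (s + p) \<and> s = - (2 * (p * q)) - s * (s + p + q)"
proof -
  define P where "P = (\<lambda>n. fst (approx_pqs n))"
  define Q where "Q = (\<lambda>n. fst (snd (approx_pqs n)))"
  define S where "S = (\<lambda>n. snd (snd (approx_pqs n)))"
  have zero: "P 0 = 0" "Q 0 = 0" "S 0 = 0" by (simp_all add: P_def Q_def S_def)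
  have next_PQS: "P (Suc n) = - X - P n * (S n + Q n)" "Q (Suc n) = - Y - Q n * (S n + P n)"
    "S (Suc n) = - (2 * (P n * Q n)) - S n * (S n + P n + Q n)" for n
    by (simp_all add: P_def Q_def S_def split: prod.split)
  have XY: "vanishes_to 1 X" "vanishes_to 1 Y"
    by (simp_all add: vanishes_to_def coeff2_X coeff2_Y)
  have one: "vanishes_to 1 (P n) \<and> vanishes_to 1 (Q n) \<and> vanishes_to 1 (S n)" for n
  proof (induction n)
    case 0 then show ?case by (simp add: zero)
  next
    case (Suc n)
    then show ?case unfolding next_PQS using XY
      by (auto simp del: One_nat_def intro!: vanishes_to_diff vanishes_to_minus vanishes_to_mult_left vanishes_to_add)
  qed
  have step: "vanishes_to (Suc n) ((- X - p * (s + q)) - (- X - p' * (s' + q')))"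
    "vanishes_to (Suc n) ((- Y - q * (s + p)) - (- Y - q' * (s' + p')))"
    "vanishes_to (Suc n) ((- (2 * (p * q)) - s * (s + p + q))
       - (- (2 * (p' * q')) - s' * (s' + p' + q')))"
    if "vanishes_to 1 p" "vanishes_to 1 q" "vanishes_to 1 s"
      "vanishes_to 1 p'" "vanishes_to 1 q'" "vanishes_to 1 s'"
      "vanishes_to n (p - p')" "vanishes_to n (q - q')" "vanishes_to n (s - s')"
    for n p q s p' q' s'
  proof -
    have sums: "vanishes_to n ((s + q) - (s' + q'))" "vanishes_to n ((s + p) - (s' + p'))"
      "vanishes_to n ((s + p + q) - (s' + p' + q'))"
      using that by (simp_all add: vanishes_to_def)
    have a: "vanishes_to (Suc n) (p * (s + q) - p' * (s' + q'))"
      "vanishes_to (Suc n) (q * (s + p) - q' * (s' + p'))"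
      "vanishes_to (Suc n) (p * q - p' * q')"
      "vanishes_to (Suc n) (s * (s + p + q) - s' * (s' + p' + q'))"
      using that sums by (auto intro!: vanishes_to_mult_diff vanishes_to_add)
    show "vanishes_to (Suc n) ((- X - p * (s + q)) - (- X - p' * (s' + q')))"
      "vanishes_to (Suc n) ((- Y - q * (s + p)) - (- Y - q' * (s' + p')))"
      "vanishes_to (Suc n) ((- (2 * (p * q)) - s * (s + p + q))
         - (- (2 * (p' * q')) - s' * (s' + p' + q')))"
      using a by (simp_all add: vanishes_to_def)
  qed
  have cauchy: "vanishes_to (Suc n) (P (Suc n) - P n) \<and> vanishes_to (Suc n) (Q (Suc n) - Q n) \<and>
    vanishes_to (Suc n) (S (Suc n) - S n)" for n
  proof (induction n)
    case 0 then show ?case using one[of "Suc 0"] by (simp add: zero)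
  next
    case (Suc n)
    then show ?case
      unfolding next_PQS(1)[of "Suc n"] next_PQS(2)[of "Suc n"] next_PQS(3)[of "Suc n"]
      unfolding next_PQS(1)[of n] next_PQS(2)[of n] next_PQS(3)[of n]
      using one[of n] one[of "Suc n"] Suc unfolding next_PQS by (intro conjI step) auto
  qed
  obtain p where p: "\<And>n. vanishes_to (Suc n) (p - P n)" using vanishes_to_limit[of P] cauchy by blast
  obtain q where q: "\<And>n. vanishes_to (Suc n) (q - Q n)" using vanishes_to_limit[of Q] cauchy by blast
  obtain s where s: "\<And>n. vanishes_to (Suc n) (s - S n)" using vanishes_to_limit[of S] cauchy by blast
  have m: "vanishes_to 1 p" "vanishes_to 1 q" "vanishes_to 1 s"
    using p[of 0] q[of 0] s[of 0] by (simp_all add: zero)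
  \<comment> \<open>Applied with \<open>F\<close> the limit of the iteration and \<open>G\<close>
    its image under the iteration map: the same sequence approximates both.\<close>
  have lim: "F = G" if "\<And>n. vanishes_to (Suc n) (F - H (Suc n))" "\<And>n. vanishes_to (Suc (Suc n)) (G - H (Suc n))"
    for F G and H :: "nat \<Rightarrow> qseries2"
  proof -
    have "vanishes_to n (F - G)" for n
    proof -
      have "vanishes_to (Suc n) ((F - H (Suc n)) - (G - H (Suc n)))"
        using that[of n] by (blast intro: vanishes_to_diff vanishes_to_mono[of "Suc (Suc n)"] le_SucI)
      then show ?thesis by (auto elim: vanishes_to_mono)
    qed
    then show ?thesis using vanishes_to_all_imp_0[of "F - G"] by simp
  qed
  have pn: "vanishes_to 1 (P n)" "vanishes_to 1 (Q n)" "vanishes_to 1 (S n)" for n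
    using one by auto
  note step' = step[OF m pn p q s, folded next_PQS]
  have "p = - X - p * (s + q)" "q = - Y - q * (s + p)" "s = - (2 * (p * q)) - s * (s + p + q)"
    using lim[of p P, OF vanishes_to_mono[OF p] step'(1)]
      lim[of q Q, OF vanishes_to_mono[OF q] step'(2)]
      lim[of s S, OF vanishes_to_mono[OF s] step'(3)] by simp_all
  then show ?thesis using m by blast
qed

text \<open>The last two relations are Q = A B at t = 0 and t = -1; the first is the coefficient of
  t minus twice the constant one, up to sign.\<close>

lemma pqs_relations:
  fixes p q s x y :: "'a::comm_ring_1"
  assumes "p = - x - p * (s + q)" "q = - y - q * (s + p)" "s = - (2 * (p * q)) - s * (s + p + q)"
  shows "s * (1 + s + p + q) + 2 * p * q = 0"
    and "x = - p * (1 + s + q)" and "y = - q * (1 + s + p)"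
proof -
  have solve: "a = - b - c \<Longrightarrow> b = - a - c" for a b c :: 'a
    by simp
  show "s * (1 + s + p + q) + 2 * p * q = 0" "x = - p * (1 + s + q)" "y = - q * (1 + s + p)"
    using assms[THEN solve] by (simp_all add: algebra_simps)
qed

text \<open>Applies the linear functional sending t^i to \<open>w\<close>i to Q = A B, grouped by A
  or by B first. Q - A B is the relation \<open>r\<close> times t + t^2.\<close>

lemma quartic_factor:
  fixes p q s x y w0 w1 w2 w3 w4 e :: "'a::comm_ring_1"
  assumes r: "s * (1 + s + p + q) + 2 * p * q = 0"
    and x: "x = - p * (1 + s + q)" and y: "y = - q * (1 + s + p)"
    and e: "w4 + 2 * w3 + w2 - x * (w2 + 2 * w1 + w0) - y * w2 = e"
  shows "(w4 - s * w3 + p * w2) + (2 + s) * (w3 - s * w2 + p * w1)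
      + (1 + s + q) * (w2 - s * w1 + p * w0) = e" (is "?AB = e")
    and "(w4 + (2 + s) * w3 + (1 + s + q) * w2) - s * (w3 + (2 + s) * w2 + (1 + s + q) * w1)
      + p * (w2 + (2 + s) * w1 + (1 + s + q) * w0) = e" (is "?BA = e")
proof -
  have "?AB = w4 + 2 * w3 + w2 - x * (w2 + 2 * w1 + w0) - y * w2
      - (s * (1 + s + p + q) + 2 * p * q) * (w1 + w2)"
    unfolding x y by (simp add: algebra_simps)
  then show "?AB = e" using e r by simp
  moreover have "?BA = ?AB" by (simp add: algebra_simps)
  ultimately show "?BA = e" by simp
qed

section \<open>Residues of the inverse of the quartic\<close>

text \<open>The coefficient of \<open>t\<^sup>n\<close> in \<open>(1 + t)\<^sup>a\<close>.\<close>
definition binom_coeff :: "int \<Rightarrow> rat \<Rightarrow> rat" where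
  "binom_coeff n a = (if n < 0 then 0 else a gchoose nat n)"

lemma binom_coeff_add_1: "binom_coeff n (a + 1) = binom_coeff n a + binom_coeff (n - 1) a"
proof (cases "n \<le> 0")
  case True
  then show ?thesis by (auto simp: binom_coeff_def)
next
  case False
  then have "nat n = Suc (nat (n - 1))" by simp
  then show ?thesis using False by (simp add: binom_coeff_def gbinomial_Suc_Suc)
qed

lemma binom_coeff_add_2:
  "binom_coeff n (a + 2) = binom_coeff n a + 2 * binom_coeff (n - 1) a + binom_coeff (n - 2) a"
  using binom_coeff_add_1[of n "a + 1"] binom_coeff_add_1[of n a] binom_coeff_add_1[of "n - 1" a]
  by (simp add: add.assoc)

text \<open>Expanding \<open>1 / (t\<^sup>2(1+t)\<^sup>2 - X(1+t)\<^sup>2 - Yt\<^sup>2)\<close> in powers of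
  \<open>X/t\<^sup>2\<close> and \<open>Y/(1+t)\<^sup>2\<close>, this is the residue at \<open>t = 0\<close> of
  \<open>t\<^sup>k\<close> times the expansion.\<close>
definition res :: "int \<Rightarrow> qseries2" where
  "res k = series2 (\<lambda>i j. of_nat ((i + j) choose i) *
     binom_coeff (2 * int i + 1 - k) (- 2 * of_nat j - 2))"

lemma coeff2_res: "coeff2 (res k) i j = of_nat ((i + j) choose i) *
     binom_coeff (2 * int i + 1 - k) (- 2 * of_nat j - 2)"
  by (simp add: res_def)

text \<open>Multiplying t^k / Q by Q leaves t^k, whose residue is nonzero only for k = -1. On
  coefficients this is Pascal's rule.\<close>

lemma res_recurrence:
  "res (k + 4) + 2 * res (k + 3) + res (k + 2) - X * (res (k + 2) + 2 * res (k + 1) + res k)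
     - Y * res (k + 2) = (if k = -1 then 1 else 0)"
proof (rule qseries2_eqI)
  fix i j
  \<comment> \<open>The factor common to all three groups: multiplying by (1+t)^2, or lowering
    \<open>j\<close> by one, turns the exponent -2j-2 into -2j.\<close>
  let ?b = "binom_coeff (2 * int i - 1 - k) (- 2 * of_nat j)"
  let ?c = "\<lambda>i j. of_nat ((i + j) choose i) :: rat"
  have 1: "coeff2 (res (k + 4) + 2 * res (k + 3) + res (k + 2)) i j = ?c i j * ?b"
    using binom_coeff_add_2[of "2 * int i - 1 - k" "- 2 * of_nat j - 2"]
    by (simp add: coeff2_res algebra_simps)
  have 2: "coeff2 (X * (res (k + 2) + 2 * res (k + 1) + res k)) i j =
      (if i = 0 then 0 else ?c (i - 1) j * ?b)"
    using binom_coeff_add_2[of "2 * int i - 1 - k" "- 2 * of_nat j - 2"]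
    by (simp add: coeff2_res coeff2_X_mult algebra_simps of_nat_diff)
  have 3: "coeff2 (Y * res (k + 2)) i j = (if j = 0 then 0 else ?c i (j - 1) * ?b)"
  proof (cases j)
    case (Suc j')
    have "- 2 * of_nat j = (- 2 * of_nat j' - 2 :: rat)" "2 * int i + 1 - (k + 2) = 2 * int i - 1 - k"
      by (simp_all add: Suc)
    then show ?thesis by (simp only: coeff2_res coeff2_Y_mult) (simp add: Suc)
  qed (simp add: coeff2_Y_mult)
  have pascal: "?c i j = (if i = 0 then 0 else ?c (i - 1) j) + (if j = 0 then 0 else ?c i (j - 1))
      + (if i = 0 \<and> j = 0 then 1 else 0)"
    by (cases i; cases j) simp_all
  have "coeff2 (res (k + 4) + 2 * res (k + 3) + res (k + 2)
      - X * (res (k + 2) + 2 * res (k + 1) + res k) - Y * res (k + 2)) i j =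
      (if i = 0 \<and> j = 0 then ?b else 0)"
    unfolding coeff2_diff[of _ "X * _"] coeff2_diff[of _ "Y * _"] 1 2 3
    by (subst pascal) (simp add: algebra_simps)
  also have "\<dots> = coeff2 (if k = -1 then 1 else 0) i j"
    by (auto simp: coeff2_1 binom_coeff_def gbinomial_0_left)
  finally show "coeff2 (res (k + 4) + 2 * res (k + 3) + res (k + 2)
      - X * (res (k + 2) + 2 * res (k + 1) + res k) - Y * res (k + 2)) i j =
      coeff2 (if k = -1 then 1 else 0) i j" .
qed

text \<open>The coefficient of X^i in the expansion of 1/Q has a pole of order 2i + 2, which t^k
  removes for all i < n.\<close>

lemma res_vanishes: "2 * int n \<le> k \<Longrightarrow> vanishes_to n (res k)"
  by (auto simp: vanishes_to_def coeff2_res binom_coeff_def)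

text \<open>Identifies \<open>res 0\<close> as minus the mixed derivative of
  \<open>2 * Phi\<close>.\<close>

lemma res_Phi: "coeff2 (res 0) i j = - 2 * of_nat (i + 1) * of_nat (j + 1) * phi_term i j"
proof -
  have "(- 2 * of_nat j - 2 :: rat) gchoose (2 * i + 1)
      = - of_nat ((2 * i + 2 * j + 2) choose (2 * i + 1))"
    \<comment> \<open>The minus sign arises because the lower index 2i + 1 is odd.\<close>
    using gbinomial_negated_upper[of "- 2 * of_nat j - 2 :: rat" "2 * i + 1"]
    by (simp add: binomial_gbinomial algebra_simps del: gbinomial_Suc_Suc binomial_Suc_Suc)
  moreover have "nat (2 * int i + 1) = 2 * i + 1" by simp
  ultimately have "coeff2 (res 0) i j =
      - (of_nat ((i + j) choose i) * of_nat ((2 * i + 2 * j + 2) choose (2 * i + 1)))"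
    by (simp add: coeff2_res binom_coeff_def del: gbinomial_Suc_Suc binomial_Suc_Suc)
  also have "of_nat ((i + j) choose i) = (fact (i + j) / (fact i * fact j) :: rat)"
    using binomial_fact[of i "i + j"] by simp
  also have "of_nat ((2 * i + 2 * j + 2) choose (2 * i + 1)) =
      (fact (2 * i + 2 * j + 2) / (fact (2 * i + 1) * fact (2 * j + 1)) :: rat)"
  proof -
    have "2 * i + 2 * j + 2 - (2 * i + 1) = 2 * j + 1" by simp
    then show ?thesis using binomial_fact[of "2 * i + 1" "2 * i + 2 * j + 2"] by simp
  qed
  also have "fact (2 * i + 2 * j + 2) = (2 * (of_nat (i + j) + 1) * fact (2 * i + 2 * j + 1) :: rat)"
    using fact_Suc[of "2 * i + 2 * j + 1", where 'a = rat] by (simp add: algebra_simps)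
  finally have res: "coeff2 (res 0) i j = - (fact (i + j) / (fact i * fact j) *
      (2 * (of_nat (i + j) + 1) * fact (2 * i + 2 * j + 1) / (fact (2 * i + 1) * fact (2 * j + 1))))" .
  have phi: "phi_term i j = ((of_nat (i + j) + 1) * fact (i + j)) * fact (2 * i + 2 * j + 1) /
      ((of_nat (i + 1) * fact i) * fact (2 * i + 1) * (of_nat (j + 1) * fact j) * fact (2 * j + 1))"
    by (simp add: phi_term_def)
  have "of_nat (i + 1) \<noteq> (0::rat)" "of_nat (j + 1) \<noteq> (0::rat)"
    by simp_all
  then show ?thesis
    unfolding res phi by (simp add: field_simps del: of_nat_Suc of_nat_add fact_Suc)
qed

text \<open>The term \<open>(s + q) * x k\<close> gains one order over the bound already known; the
  other two terms are handled by descending in \<open>k\<close> from the range where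
  \<open>large\<close> applies.\<close>

lemma backward_recurrence_vanishes:
  assumes rec: "\<And>k. 0 \<le> k \<Longrightarrow> x k = - (2 + s) * x (k + 1) - x (k + 2) - (s + q) * x (k::int)"
    and s: "vanishes_to 1 s" and q: "vanishes_to 1 q"
    and large: "\<And>n k. 2 * int n \<le> k \<Longrightarrow> vanishes_to n (x k)"
    and "0 \<le> k"
  shows "x k = 0"
proof -
  have "\<forall>k\<ge>0. vanishes_to n (x k)" for n
  proof (induction n)
    case (Suc n)
    have "\<forall>k\<ge>0. 2 * int (Suc n) - int d \<le> k \<longrightarrow> vanishes_to (Suc n) (x k)" for d
    proof (induction d)
      case 0
      then show ?case using large by auto
    next
      case (Suc d)
      show ?case
      proof (intro allI impI)
        fix k :: int assume k: "0 \<le> k" "2 * int (Suc n) - int (Suc d) \<le> k"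
        then have "vanishes_to (Suc n) (x (k + 1))" "vanishes_to (Suc n) (x (k + 2))"
          using Suc by auto
        moreover have "vanishes_to (Suc n) ((s + q) * x k)"
          using s q k \<open>\<forall>k\<ge>0. vanishes_to n (x k)\<close> by (intro vanishes_to_Suc_mult vanishes_to_add) auto
        ultimately have "vanishes_to (Suc n)
            (- (2 + s) * x (k + 1) - x (k + 2) - (s + q) * x k)"
          by (intro vanishes_to_diff) (assumption | rule vanishes_to_mult_left, assumption)+
        then show "vanishes_to (Suc n) (x k)"
          by (simp only: rec[OF k(1), symmetric])
      qed
    qed
    from this[of "2 * Suc n"] show ?case by auto
  qed simp
  then show ?thesis using \<open>0 \<le> k\<close> vanishes_to_all_imp_0 by blast
qed

lemma forward_recurrence_vanishes:
  assumes rec: "\<And>k. k \<le> 0 \<Longrightarrow> y k = s * y (k - 1) - p * y (k - 2)"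
    and s: "vanishes_to 1 s" and p: "vanishes_to 1 p"
    and "k \<le> (0::int)"
  shows "y k = 0"
proof -
  have "\<forall>k\<le>0. vanishes_to n (y k)" for n
  proof (induction n)
    case (Suc n)
    show ?case
    proof (intro allI impI)
      fix k :: int assume "k \<le> 0"
      then show "vanishes_to (Suc n) (y k)"
        using Suc s p by (subst rec) (auto intro!: vanishes_to_diff vanishes_to_Suc_mult simp del: One_nat_def)
    qed
  qed simp
  then show ?thesis using \<open>k \<le> 0\<close> vanishes_to_all_imp_0 by blast
qed

lemma res_0_eq:
  assumes p: "p = - X - p * (s + q)" and q: "q = - Y - q * (s + p)"
    and s: "s = - (2 * (p * q)) - s * (s + p + q)"
    and m: "vanishes_to 1 p" "vanishes_to 1 q" "vanishes_to 1 s"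
  shows "res 0 * ((1 + s + q - p) * ((2 + 2 * s) * s + (1 + s + q - p)) + p * (2 + 2 * s) ^ 2)
    = - (2 + 2 * s)"
proof -
  define x where "x k = res (k + 2) - s * res (k + 1) + p * res k" for k
  define y where "y k = res (k + 2) + (2 + s) * res (k + 1) + (1 + s + q) * res k" for k
  have x_rec: "x (k + 2) + (2 + s) * x (k + 1) + (1 + s + q) * x k = (if k = -1 then 1 else 0)"
    and y_rec: "y (k + 2) - s * y (k + 1) + p * y k = (if k = -1 then 1 else 0)" for k
    using quartic_factor[OF pqs_relations[OF p q s] res_recurrence[of k]]
    by (simp_all add: x_def y_def add.assoc)
  have x_0: "x k = 0" if "0 \<le> k" for k
  proof (rule backward_recurrence_vanishes[OF _ m(3,2) _ that])
    fix k :: int assume "0 \<le> k"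
    then have "x (k + 2) + (2 + s) * x (k + 1) + (1 + s + q) * x k = 0"
      using x_rec[of k] by simp
    then have "x k = x k - (x (k + 2) + (2 + s) * x (k + 1) + (1 + s + q) * x k)"
      by simp
    also have "\<dots> = - (2 + s) * x (k + 1) - x (k + 2) - (s + q) * x k"
      by (simp add: algebra_simps)
    finally show "x k = - (2 + s) * x (k + 1) - x (k + 2) - (s + q) * x k" .
  next
    fix n and k :: int assume "2 * int n \<le> k"
    then show "vanishes_to n (x k)"
      unfolding x_def by (intro vanishes_to_add vanishes_to_diff vanishes_to_mult_left res_vanishes) auto
  qed
  have y_0: "y k = 0" if "k \<le> 0" for k
  proof (rule forward_recurrence_vanishes[OF _ m(3,1) that])
    fix k :: int assume "k \<le> 0"
    then have "y k - s * y (k - 1) + p * y (k - 2) = 0"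
      using y_rec[of "k - 2"] by simp
    then show "y k = s * y (k - 1) - p * y (k - 2)"
      by (simp add: algebra_simps)
  qed
  have "y 1 = 1"
    using y_rec[of "-1"] y_0[of 0] y_0[of "-1"] by simp
  then have "res 3 + (2 + s) * res 2 + (1 + s + q) * res 1 = 1"
    "res 2 + (2 + s) * res 1 + (1 + s + q) * res 0 = 0"
    "res 2 - s * res 1 + p * res 0 = 0" "res 3 - s * res 2 + p * res 1 = 0"
    using y_0[of 0] x_0[of 0] x_0[of 1] by (simp_all add: x_def y_def)
  then show ?thesis by algebra
qed

section \<open>Partial derivatives\<close>

definition dX :: "qseries2 \<Rightarrow> qseries2" where
  "dX F = Abs_fps (\<lambda>j. fps_deriv (fps_nth F j))"

abbreviation dY :: "qseries2 \<Rightarrow> qseries2" where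
  "dY \<equiv> fps_deriv"

lemma coeff2_dX: "coeff2 (dX F) i j = of_nat (i + 1) * coeff2 F (i + 1) j"
  by (simp add: dX_def coeff2_def)

lemma coeff2_dY: "coeff2 (dY F) i j = of_nat (j + 1) * coeff2 F i (j + 1)"
  by (simp add: coeff2_def fps_of_nat[symmetric] del: of_nat_Suc)

lemma dX_add: "dX (F + G) = dX F + dX G"
  and dX_diff: "dX (F - G) = dX F - dX G"
  and dX_minus: "dX (- F) = - dX F"
  and dX_1: "dX 1 = 0"
  and dX_X: "dX X = 1"
  and dX_Y: "dX Y = 0"
  by (rule qseries2_eqI; simp add: coeff2_dX coeff2_1 coeff2_X coeff2_Y algebra_simps)+

lemma dX_numeral_mult: "dX (numeral n * F) = numeral n * dX F"
  by (rule qseries2_eqI) (simp add: coeff2_dX)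

lemma dX_numeral: "dX (numeral n) = 0"
  using dX_numeral_mult[of n 1] by (simp add: dX_1)

lemma dX_0: "dX 0 = 0"
  by (rule qseries2_eqI) (simp add: coeff2_dX)

lemma dX_mult: "dX (F * G) = F * dX G + dX F * G"
  by (simp add: dX_def fps_eq_iff fps_mult_nth fps_deriv_sum sum.distrib fps_sum_nth)

lemmas dX_simps = dX_0 dX_numeral dX_add dX_diff dX_minus dX_1 dX_X dX_Y dX_numeral_mult dX_mult

lemma dY_simps: "dY X = 0" "dY Y = 1" "dY (numeral n * F) = numeral n * dY F"
  by (simp_all add: X_def Y_def numeral_fps_const)

text \<open>The Jacobian determinant of the system defining \<open>p, q, s\<close>.\<close>
definition jacobian :: "'a::comm_ring_1 \<Rightarrow> 'a \<Rightarrow> 'a \<Rightarrow> 'a" where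
  "jacobian p q s =
     (1 + s + q) * ((1 + s + p) * (1 + 2 * s + p + q) - q * (s + 2 * p))
     - p * (q * (1 + 2 * s + p + q) - q * (s + 2 * q))
     + p * (q * (s + 2 * p) - (1 + s + p) * (s + 2 * q))"

lemma jacobian_cramer:
  fixes p q s dp dq ds u v :: "'a::comm_ring_1"
  assumes e1: "dp * (1 + s + q) + p * (ds + dq) = u"
    and e2: "dq * (1 + s + p) + q * (ds + dp) = v"
    and e3: "ds * (1 + s + p + q) + s * (ds + dp + dq) + 2 * (dp * q + p * dq) = 0"
  shows "jacobian p q s * dp =
      ((1 + s + p) * (1 + 2 * s + p + q) - q * (s + 2 * p)) * u - p * (1 + s + q - p) * v"
    and "jacobian p q s * dq =
      ((1 + s + q) * (1 + 2 * s + p + q) - p * (s + 2 * q)) * v - q * (1 + s + p - q) * u"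
    and "jacobian p q s * ds = (q * (s + 2 * p) - (1 + s + p) * (s + 2 * q)) * u
      + (p * (s + 2 * q) - (1 + s + q) * (s + 2 * p)) * v"
proof -
  let ?e3 = "ds * (1 + s + p + q) + s * (ds + dp + dq) + 2 * (dp * q + p * dq)"
  have "jacobian p q s * dp =
      ((1 + s + p) * (1 + 2 * s + p + q) - q * (s + 2 * p)) * u - p * (1 + s + q - p) * v
      + (p * q - p * (1 + s + p)) * ?e3"
    unfolding e1[symmetric] e2[symmetric] jacobian_def by (simp add: algebra_simps)
  moreover have "jacobian p q s * dq =
      ((1 + s + q) * (1 + 2 * s + p + q) - p * (s + 2 * q)) * v - q * (1 + s + p - q) * u
      + (p * q - (1 + s + q) * q) * ?e3"
    unfolding e1[symmetric] e2[symmetric] jacobian_def by (simp add: algebra_simps)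
  moreover have "jacobian p q s * ds = (q * (s + 2 * p) - (1 + s + p) * (s + 2 * q)) * u
      + (p * (s + 2 * q) - (1 + s + q) * (s + 2 * p)) * v
      + ((1 + s + q) * (1 + s + p) - p * q) * ?e3"
    unfolding e1[symmetric] e2[symmetric] jacobian_def by (simp add: algebra_simps)
  ultimately show "jacobian p q s * dp =
      ((1 + s + p) * (1 + 2 * s + p + q) - q * (s + 2 * p)) * u - p * (1 + s + q - p) * v"
    and "jacobian p q s * dq =
      ((1 + s + q) * (1 + 2 * s + p + q) - p * (s + 2 * q)) * v - q * (1 + s + p - q) * u"
    and "jacobian p q s * ds = (q * (s + 2 * p) - (1 + s + p) * (s + 2 * q)) * u
      + (p * (s + 2 * q) - (1 + s + q) * (s + 2 * p)) * v"
    by (simp_all only: e3 mult_zero_right add_0_right)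
qed

lemma first_derivative_identity:
  fixes p q s dp dq ds :: "'a::idom"
  assumes r: "s * (1 + s + p + q) + 2 * p * q = 0"
    and d0: "jacobian p q s \<noteq> 0"
    and e: "dp * (1 + s + q) + p * (ds + dq) = - 1" "dq * (1 + s + p) + q * (ds + dp) = 0"
      "ds * (1 + s + p + q) + s * (ds + dp + dq) + 2 * (dp * q + p * dq) = 0"
  shows "(1 + s + p + q) * (- ((1 + s) * (dp + dq)) - ds * (p + q) - 2 * s * ds) = 1 + s + p - q"
proof -
  have "jacobian p q s * ((1 + s + p + q) * (- ((1 + s) * (dp + dq)) - ds * (p + q) - 2 * s * ds)
      - (1 + s + p - q)) = 0"
    using r jacobian_cramer[OF e] jacobian_def[of p q s] by algebra
  then show ?thesis using d0 by simp
qed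

lemma second_derivative_identity:
  fixes p q s dp dq ds K rho w :: "'a::idom"
  assumes r: "s * (1 + s + p + q) + 2 * p * q = 0"
    and d0: "jacobian p q s \<noteq> 0"
    and e: "dp * (1 + s + q) + p * (ds + dq) = 0" "dq * (1 + s + p) + q * (ds + dp) = - 1"
      "ds * (1 + s + p + q) + s * (ds + dp + dq) + 2 * (dp * q + p * dq) = 0"
    and K: "K = 1 + s + q - p"
    and rho: "rho = K * ((2 + 2 * s) * s + K) + p * (2 + 2 * s) ^ 2" and rho0: "rho \<noteq> 0"
    and w: "w * rho = - (2 + 2 * s)"
  shows "(1 + s + p + q) ^ 2 * w = 2 * (dq * (1 + s + p + q) - q * (ds + dp + dq))"
proof -
  have "jacobian p q s * rho * ((1 + s + p + q) ^ 2 * w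
      - 2 * (dq * (1 + s + p + q) - q * (ds + dp + dq))) = 0"
    using r jacobian_cramer[OF e] jacobian_def[of p q s] K rho w by algebra
  then show ?thesis using d0 rho0 by simp
qed

section \<open>The sextic equation\<close>

lemma sextic_identity:
  fixes p q s x y z :: "'a::idom"
  assumes "s * (1 + s + p + q) + 2 * p * q = 0"
    and "x = - p * (1 + s + q)" and "y = - q * (1 + s + p)"
    and "z = 1 - (1 + s) * (p + q) - s ^ 2"
    and "I = (x + y - 1) ^ 2 - 12 * (x * y - x - y)"
    and "J = (x + y - 1) ^ 2 * (x * y - x - y) - 6 * (x * y - x - y) ^ 2
      + 9 * (x + y - 1) * (- (x * y))"
    and "D = (1 + x) ^ 2 * (1 + y) ^ 2 * (x - y) ^ 2"
  shows "z ^ 6 - I * z ^ 4 - 8 * J * z ^ 2 - 16 * D = 0"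
  using assms by algebra

definition at_X_0 :: "qseries2 \<Rightarrow> rat fps" where
  "at_X_0 F = Abs_fps (\<lambda>j. fps_nth (fps_nth F j) 0)"

lemma at_X_0_simps:
  "at_X_0 (F + G) = at_X_0 F + at_X_0 G" "at_X_0 (F - G) = at_X_0 F - at_X_0 G"
  "at_X_0 (- F) = - at_X_0 F" "at_X_0 (F * G) = at_X_0 F * at_X_0 G"
  "at_X_0 (numeral n) = numeral n" "at_X_0 1 = 1" "at_X_0 X = 0" "at_X_0 Y = fps_X"
  by (simp_all add: at_X_0_def X_def Y_def fps_eq_iff fps_mult_nth fps_sum_nth fps_X_def
      numeral_fps_const)

lemma coeff2_at_X_0: "coeff2 F 0 j = fps_nth (at_X_0 F) j"
  by (simp add: coeff2_def at_X_0_def)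

lemma boundary_value:
  fixes p q s x y :: "'a::idom"
  assumes "p = - x - p * (s + q)" "q = - y - q * (s + p)" "s = - (2 * (p * q)) - s * (s + p + q)"
    and "x = 0" and "1 + s + q \<noteq> 0" "1 + s + p + q \<noteq> 0"
  shows "1 - (1 + s) * (p + q) - s ^ 2 = 1 + y"
proof -
  note rel = pqs_relations[OF assms(1-3)]
  have "p = 0" using rel(2) assms(4,5) by simp
  moreover from this have "s = 0" using rel(1) assms(6) by simp
  ultimately show ?thesis using rel(3) by simp
qed

lemma Z3_eq:
  assumes p: "p = - X - p * (s + q)" and q: "q = - Y - q * (s + p)"
    and s: "s = - (2 * (p * q)) - s * (s + p + q)"
    and m: "vanishes_to 1 p" "vanishes_to 1 q" "vanishes_to 1 s"
  shows "Z3 = 1 - (1 + s) * (p + q) - s ^ 2"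
proof -
  define z where "z = 1 - (1 + s) * (p + q) - s ^ 2"
  have r: "s * (1 + s + p + q) + 2 * p * q = 0"
    using pqs_relations[OF p q s] by blast
  have x: "X = - p * (1 + s + q)" and y: "Y = - q * (1 + s + p)"
    using pqs_relations[OF p q s] by blast+
  have const: "fps_nth (fps_nth p 0) 0 = 0" "fps_nth (fps_nth q 0) 0 = 0" "fps_nth (fps_nth s 0) 0 = 0"
    using m by (auto simp: vanishes_to_def coeff2_def)
  have nonzero: "F \<noteq> 0" if "fps_nth (fps_nth F 0) 0 \<noteq> 0" for F :: qseries2
    using that by auto
  have jac: "jacobian p q s \<noteq> 0"
    by (rule nonzero) (simp add: jacobian_def const)
  have T: "1 + s + p + q \<noteq> 0"
    by (rule nonzero) (simp add: const)
  have rho: "(1 + s + q - p) * ((2 + 2 * s) * s + (1 + s + q - p)) + p * (2 + 2 * s) ^ 2 \<noteq> 0"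
    by (rule nonzero) (simp add: const)

  let ?T = "1 + s + p + q"
  have "dX p * (1 + s + q) + p * (dX s + dX q) = - 1"
    "dX q * (1 + s + p) + q * (dX s + dX p) = 0"
    "dX s * ?T + s * (dX s + dX p + dX q) + 2 * (dX p * q + p * dX q) = 0"
    using arg_cong[OF x, of dX] arg_cong[OF y, of dX] arg_cong[OF r, of dX]
    by (simp_all add: dX_simps algebra_simps eq_neg_iff_add_eq_0)
  note first_derivative_identity[OF r jac this]
  moreover have "dX z = - ((1 + s) * (dX p + dX q)) - dX s * (p + q) - 2 * s * dX s"
    by (simp add: z_def dX_simps power2_eq_square algebra_simps)
  ultimately have dX_z: "?T * dX z = 1 + s + p - q"
    by simp

  have "dY p * (1 + s + q) + p * (dY s + dY q) = 0"
    "dY q * (1 + s + p) + q * (dY s + dY p) = - 1"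
    "dY s * ?T + s * (dY s + dY p + dY q) + 2 * (dY p * q + p * dY q) = 0"
    using arg_cong[OF x, of dY] arg_cong[OF y, of dY] arg_cong[OF r, of dY]
    by (simp_all add: dY_simps algebra_simps eq_neg_iff_add_eq_0)
  note second_derivative_identity[OF r jac this refl refl rho res_0_eq[OF p q s m]]
  moreover have "?T * dY (dX z) + (dY s + dY p + dY q) * dX z = dY s + dY p - dY q"
    using arg_cong[OF dX_z, of dY] by (simp add: algebra_simps)
  ultimately have "?T ^ 2 * (dY (dX z) + res 0) = 0"
    using dX_z by algebra
  then have mixed: "dY (dX z) = - res 0"
    using T by (simp add: eq_neg_iff_add_eq_0)

  have "coeff2 z i j = coeff2 Z3 i j" for i j
  proof (cases "i = 0 \<or> j = 0")
    case True
    have "fps_nth z 0 = 1 + fps_X"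
    proof -
      have "1 - (1 + fps_nth s 0) * (fps_nth q 0 + fps_nth p 0) - fps_nth s 0 ^ 2 = 1 + fps_nth X 0"
      proof (rule boundary_value)
        show "fps_nth q 0 = - fps_nth Y 0 - fps_nth q 0 * (fps_nth s 0 + fps_nth p 0)"
          using arg_cong[OF q, of "\<lambda>F. fps_nth F 0"] by simp
        show "fps_nth p 0 = - fps_nth X 0 - fps_nth p 0 * (fps_nth s 0 + fps_nth q 0)"
          using arg_cong[OF p, of "\<lambda>F. fps_nth F 0"] by simp
        show "fps_nth s 0 = - (2 * (fps_nth q 0 * fps_nth p 0))
            - fps_nth s 0 * (fps_nth s 0 + fps_nth q 0 + fps_nth p 0)"
          using arg_cong[OF s, of "\<lambda>F. fps_nth F 0"] by (simp add: algebra_simps)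
        show "fps_nth Y 0 = 0"
          by (simp add: Y_def)
        show "1 + fps_nth s 0 + fps_nth p 0 \<noteq> 0" "1 + fps_nth s 0 + fps_nth q 0 + fps_nth p 0 \<noteq> 0"
          using const by (auto simp: fps_eq_iff intro!: exI[of _ 0])
      qed
      then show ?thesis by (simp add: z_def X_def add.commute fps_nth_power_0)
    qed
    then have "coeff2 z i 0 = coeff2 Z3 i 0"
      by (simp add: coeff2_def Z3_def Phi_def series2_def X_def Y_def numeral_fps_const)
    moreover have "at_X_0 z = 1 + fps_X"
    proof -
      have "1 - (1 + at_X_0 s) * (at_X_0 p + at_X_0 q) - at_X_0 s ^ 2 = 1 + at_X_0 Y"
      proof (rule boundary_value)
        show "at_X_0 p = - at_X_0 X - at_X_0 p * (at_X_0 s + at_X_0 q)"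
          using arg_cong[OF p, of at_X_0] by (simp add: at_X_0_simps)
        show "at_X_0 q = - at_X_0 Y - at_X_0 q * (at_X_0 s + at_X_0 p)"
          using arg_cong[OF q, of at_X_0] by (simp add: at_X_0_simps)
        show "at_X_0 s = - (2 * (at_X_0 p * at_X_0 q)) - at_X_0 s * (at_X_0 s + at_X_0 p + at_X_0 q)"
          using arg_cong[OF s, of at_X_0] by (simp add: at_X_0_simps)
        show "at_X_0 X = 0"
          by (simp add: at_X_0_simps)
        show "1 + at_X_0 s + at_X_0 q \<noteq> 0" "1 + at_X_0 s + at_X_0 p + at_X_0 q \<noteq> 0"
          using const by (auto simp: fps_eq_iff at_X_0_def intro!: exI[of _ 0])
      qed
      then show ?thesis by (simp add: z_def at_X_0_simps power2_eq_square)
    qed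
    then have "coeff2 z 0 j = fps_nth (1 + fps_X) j"
      by (subst coeff2_at_X_0) simp
    then have "coeff2 z 0 j = coeff2 Z3 0 j"
      by (simp add: coeff2_def Z3_def Phi_def series2_def X_def Y_def numeral_fps_const)
    ultimately show ?thesis using True by auto
  next
    case False
    then obtain a b where ab: "i = a + 1" "j = b + 1"
      by (metis Suc_eq_plus1 not0_implies_Suc)
    have "of_nat (b + 1) * (of_nat (a + 1) * coeff2 z i j) = - coeff2 (res 0) a b"
      using arg_cong[OF mixed, of "\<lambda>F. coeff2 F a b"] by (simp add: coeff2_dX coeff2_dY ab del: of_nat_Suc)
    also have "\<dots> = of_nat (b + 1) * (of_nat (a + 1) * (2 * phi_term a b))"
      by (simp add: res_Phi algebra_simps)
    finally have "coeff2 z i j = 2 * phi_term a b"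
      by simp
    also have "\<dots> = coeff2 Z3 i j"
      using coeff2_Phi(1)[of a b] by (simp add: Z3_def coeff2_1 coeff2_X coeff2_Y ab)
    finally show ?thesis .
  qed
  then show ?thesis unfolding z_def by (rule qseries2_eqI[symmetric])
qed

theorem theorem4p1:
  shows "Z3 ^ 6 - I_inv * Z3 ^ 4 - 8 * J_inv * Z3 ^ 2 - 16 * D_disc = 0 \<and>
    (let U = Z3 ^ 2 in U ^ 3 - I_inv * U ^ 2 - 8 * J_inv * U - 16 * D_disc = 0)"
proof -
  obtain p q s where m: "vanishes_to 1 p" "vanishes_to 1 q" "vanishes_to 1 s"
    and p: "p = - X - p * (s + q)" and q: "q = - Y - q * (s + p)"
    and s: "s = - (2 * (p * q)) - s * (s + p + q)"
    using ex_pqs by blast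
  have "s * (1 + s + p + q) + 2 * p * q = 0"
    using pqs_relations[OF p q s] by blast
  moreover have "X = - p * (1 + s + q)" "Y = - q * (1 + s + p)"
    using pqs_relations[OF p q s] by blast+
  ultimately have "Z3 ^ 6 - I_inv * Z3 ^ 4 - 8 * J_inv * Z3 ^ 2 - 16 * D_disc = 0"
    by (rule sextic_identity[OF _ _ _ Z3_eq[OF p q s m]])
      (simp_all add: I_inv_def J_inv_def D_disc_def sigma1_def sigma2_def sigma3_def)
  then show ?thesis by (simp flip: power_mult)
qed

end
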